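(* Let $N\ge1$ be an integer. For any vector $c=(c^1,\dots,c^N)$ of strictly positive reals and any $a,\tilde a\in\mathbb{A}_{\mathbb{G}}$, $$a\preceq\tilde a\implies N^{\rm eff}(a,c)\le N^{\rm eff}(\tilde a,c).$$
   Context: $[N]:=\{1,\dots,N\}$. A graph $G=(V,E)$ consists of a vertex set $V\subseteq[N]$ and an edge set $E\subseteq V^2$, with the convention that $(i,i)\in E$ for every $i\in V$. For $V\subseteq[N]$, $\kappa(V):=(V,V^2)$ is the complete graph on $V$. For graphs with disjoint vertex sets, $(V,E)\cup(V',E'):=(V\cup V',E\cup E')$. A graph $G$ is a disjoint union of complete graphs if $G=\bigcup_{k\in[K]}\kappa(V_k)$ for some $K\in[N]$ and pairwise disjoint subsets $V_1,\dots,V_K$ of $[N]$. $\mathbb{G}_V$ is the set of graphs with vertex set $V$ that are disjoint unions of complete graphs, and $\mathbb{G}:=\bigcup_{V\subseteq[N]}\mathbb{G}_V$. For $G=(V,E)\in\mathbb{G}$, $\phi(G)$ is the $N\times N$ matrix with entries $\phi(G)^{ij}=\mathbb{I}\{(i,j)\in E\}/\sum_{k\in[N]}\mathbb{I}\{(i,k)\in E\}$ for $(i,j)\in V^2$ and $\phi(G)^{ij}=0$ otherwise. $\mathbb{A}_{\mathbb{G}}:=\{\phi(G):G\in\mathbb{G}\}$; the map $\phi:\mathbb{G}\to\mathbb{A}_{\mathbb{G}}$ is a bijection with inverse $\phi^{-1}$. For $G=(V,E)$, $\tilde G=(\tilde V,\tilde E)$ in $\mathbb{G}$, write $G\preceq\tilde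 G$ if and only if $V=\tilde V$ and $E\subseteq\tilde E$. For $a,\tilde a\in\mathbb{A}_{\mathbb{G}}$, write $a\preceq\tilde a$ if and only if $\phi^{-1}(a)\preceq\phi^{-1}(\tilde a)$. The effective sample size is $N^{\rm eff}(a,c):=0$ if $a$ is the zero matrix and otherwise $$N^{\rm eff}(a,c):=\frac{\left(\sum_{i=1}^N\sum_{j=1}^N a^{ij}c^j\right)^2}{\sum_{i=1}^N\left(\sum_{j=1}^N a^{ij}c^j\right)^2}.$$ *)

theory Defs
  imports "HOL-Analysis.Analysis" "HOL-Library.Disjoint_Sets"
begin

text \<open>
  The index set \<open>[N]\<close> is the universe of an arbitrary nonempty finite type \<open>'n\<close>, with
  \<open>N = CARD('n) \<ge> 1\<close>. Vectors and matrices are those of HOL-Analysis, and \<open>a $ i $ j\<close> is the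
  entry \<open>a\<^sup>i\<^sup>j\<close>. A graph is a pair of a vertex set and a set of ordered edges.
\<close>

type_synonym 'n graph = "'n set \<times> ('n \<times> 'n) set"

definition is_graph :: "'n graph \<Rightarrow> bool" where
  "is_graph G \<longleftrightarrow> snd G \<subseteq> fst G \<times> fst G \<and> (\<forall>i\<in>fst G. (i, i) \<in> snd G)"

definition complete_graph :: "'n set \<Rightarrow> 'n graph" where
  "complete_graph V = (V, V \<times> V)"

definition graph_UN :: "'i set \<Rightarrow> ('i \<Rightarrow> 'n graph) \<Rightarrow> 'n graph" where
  "graph_UN I H = (\<Union>k\<in>I. fst (H k), \<Union>k\<in>I. snd (H k))"

text \<open>The sets \<open>V k\<close> may be empty; in particular the empty graph qualifies, with \<open>K = 1\<close>.\<close>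

definition disjoint_union_of_complete :: "'n::finite graph \<Rightarrow> bool" where
  "disjoint_union_of_complete G \<longleftrightarrow>
     (\<exists>K\<in>{1..CARD('n)}. \<exists>V::nat \<Rightarrow> 'n set.
        disjoint_family_on V {1..K} \<and> G = graph_UN {1..K} (\<lambda>k. complete_graph (V k)))"

definition cluster_graphs_on :: "'n::finite set \<Rightarrow> 'n graph set" where
  "cluster_graphs_on V = {G. is_graph G \<and> fst G = V \<and> disjoint_union_of_complete G}"

definition cluster_graphs :: "'n::finite graph set" where
  "cluster_graphs = (\<Union>V. cluster_graphs_on V)"

definition phi :: "'n::finite graph \<Rightarrow> real ^ 'n ^ 'n" where
  "phi G = (\<chi> i j. if i \<in> fst G \<and> j \<in> fst G
                   then of_bool ((i, j) \<in> snd G) / (\<Sum>k\<in>UNIV. of_bool ((i, k) \<in> snd G))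
                   else 0)"

definition cluster_matrices :: "(real ^ 'n::finite ^ 'n) set" where
  "cluster_matrices = phi ` cluster_graphs"

definition graph_le :: "'n graph \<Rightarrow> 'n graph \<Rightarrow> bool" where
  "graph_le G G' \<longleftrightarrow> fst G = fst G' \<and> snd G \<subseteq> snd G'"

text \<open>Meaningful for members of \<^const>\<open>cluster_matrices\<close>; see \<open>bij_betw_phi\<close> below.\<close>

definition matrix_le :: "real ^ 'n::finite ^ 'n \<Rightarrow> real ^ 'n ^ 'n \<Rightarrow> bool" where
  "matrix_le a a' \<longleftrightarrow>
     graph_le (the_inv_into cluster_graphs phi a) (the_inv_into cluster_graphs phi a')"

definition N_eff :: "real ^ 'n::finite ^ 'n \<Rightarrow> real ^ 'n \<Rightarrow> real" where
  "N_eff a c =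
     (if a = 0 then 0
      else (\<Sum>i\<in>UNIV. \<Sum>j\<in>UNIV. a $ i $ j * c $ j)\<^sup>2 /
           (\<Sum>i\<in>UNIV. (\<Sum>j\<in>UNIV. a $ i $ j * c $ j)\<^sup>2))"

lemma phi_neq_0_iff:
  assumes "is_graph G"
  shows "phi G $ i $ j \<noteq> 0 \<longleftrightarrow> (i, j) \<in> snd G"
proof (cases "(i, j) \<in> snd G")
  case True
  then have "(\<Sum>k\<in>UNIV. of_bool ((i, k) \<in> snd G) :: real) > 0"
    by (intro sum_pos2[where i = j]) auto
  then show ?thesis
    using True assms by (auto simp: phi_def is_graph_def)
qed (simp add: phi_def)

lemma bij_betw_phi: "bij_betw phi cluster_graphs cluster_matrices"
  unfolding bij_betw_def cluster_matrices_def
proof (intro conjI inj_onI refl)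
  fix G H :: "'n::finite graph"
  assume G: "G \<in> cluster_graphs" and H: "H \<in> cluster_graphs" and eq: "phi G = phi H"
  have gr: "is_graph G" "is_graph H"
    using G H by (auto simp: cluster_graphs_def cluster_graphs_on_def)
  have "(i, j) \<in> snd G \<longleftrightarrow> (i, j) \<in> snd H" for i j
    using phi_neq_0_iff[OF gr(1), of i j] phi_neq_0_iff[OF gr(2), of i j] eq by simp
  then have E: "snd G = snd H"
    by auto
  have "fst K = {i. (i, i) \<in> snd K}" if "is_graph K" for K :: "'n graph"
    using that by (auto simp: is_graph_def)
  with gr E have "fst G = fst H"
    by simp
  with E show "G = H"
    by (simp add: prod_eq_iff)
qed

end

(*
  Cluster matrices are symmetric and idempotent, phi H ** phi G = phi H whenever G is finer than H,
  and their columns sum to 1 over the common vertex set. So both numerators agree, and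
  phi H *v c is an orthogonal projection of phi G *v c, which can only shrink the denominator.
*)
theory Submission
  imports Defs
begin

text \<open>Transitivity is where disjointness enters: the middle vertex of two consecutive edges
  lies in only one block. Everything below uses the clusters only as equivalence classes.\<close>

lemma cluster_graph_equiv:
  assumes "G \<in> cluster_graphs"
  shows "equiv (fst G) (snd G)"
proof -
  obtain K :: nat and V where dis: "disjoint_family_on V {1..K}"
    and G: "G = graph_UN {1..K} (\<lambda>k. complete_graph (V k))"
    using assms
    unfolding cluster_graphs_def cluster_graphs_on_def disjoint_union_of_complete_def by blast
  have E: "snd G = (\<Union>k\<in>{1..K}. V k \<times> V k)" and V: "fst G = (\<Union>k\<in>{1..K}. V k)"
    using G by (simp_all add: graph_UN_def complete_graph_def)
  have "trans (snd G)"
  proof (rule transI)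
    fix x y z assume "(x, y) \<in> snd G" "(y, z) \<in> snd G"
    then obtain k l where kl: "k \<in> {1..K}" "l \<in> {1..K}" "x \<in> V k" "y \<in> V k" "y \<in> V l" "z \<in> V l"
      unfolding E by blast
    then have "k = l"
      using dis unfolding disjoint_family_on_def by blast
    with kl show "(x, z) \<in> snd G" unfolding E by blast
  qed
  moreover have "refl_on (fst G) (snd G)" "sym (snd G)" "snd G \<subseteq> fst G \<times> fst G"
    unfolding E V by (auto simp: refl_on_def sym_def)
  ultimately show ?thesis
    by (simp add: equiv_def)
qed

text \<open>An edge has both ends in \<open>fst G\<close>, so the vertex test in \<open>phi\<close>
  is redundant. Row i thus averages over the class of i.\<close>

lemma phi_nth_equiv:
  assumes "equiv (fst G) (snd G)"
  shows "phi G $ i $ j = of_bool ((i, j) \<in> snd G) / card (snd G `` {i})"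
proof -
  have "snd G \<subseteq> fst G \<times> fst G"
    using assms by (rule equiv_type)
  moreover have "(\<Sum>k\<in>UNIV. of_bool ((i, k) \<in> snd G) :: real) = card (snd G `` {i})"
    by (simp add: Image_def of_bool_def sum.If_cases)
  ultimately show ?thesis
    by (auto simp: phi_def)
qed

text \<open>Related indices have the same class, hence the same denominator.\<close>

lemma phi_sym:
  assumes "equiv (fst G) (snd G)"
  shows "phi G $ i $ j = phi G $ j $ i"
proof (cases "(i, j) \<in> snd G")
  case True
  then have "(j, i) \<in> snd G"
    using assms by (meson equiv_def symD)
  moreover have "snd G `` {i} = snd G `` {j}"
    using assms True by (rule equiv_class_eq)
  ultimately show ?thesis
    using True by (simp add: phi_nth_equiv[OF assms])
next
  case False
  then have "(j, i) \<notin> snd G"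
    using assms by (meson equiv_def symD)
  with False show ?thesis
    by (simp add: phi_nth_equiv[OF assms])
qed

lemma sum_phi_column:
  assumes G: "equiv (fst G) (snd G)"
  shows "(\<Sum>k\<in>UNIV. phi G $ k $ j) = of_bool (j \<in> fst G)"
proof -
  have "(\<Sum>k\<in>UNIV. phi G $ k $ j) = (\<Sum>k\<in>UNIV. of_bool ((j, k) \<in> snd G)) / card (snd G `` {j})"
    unfolding phi_sym[OF G, of _ j] sum_divide_distrib by (simp only: phi_nth_equiv[OF G])
  also have "(\<Sum>k\<in>UNIV. of_bool ((j, k) \<in> snd G) :: real) = card (snd G `` {j})"
    by (simp add: Image_def of_bool_def sum.If_cases)
  \<comment> \<open>If j is not a vertex, its class is empty and 0 / 0 = 0 gives the right
    value.\<close>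
  also have "real (card (snd G `` {j})) / card (snd G `` {j}) = of_bool (j \<in> fst G)"
    using equiv_class_self[OF G, of j] equiv_type[OF G] by (auto simp: card_eq_0_iff)
  finally show ?thesis .
qed

text \<open>Each row of \<open>phi H\<close> is constant on the classes of H, hence on the smaller
  classes of G, so averaging over the latter first changes nothing.\<close>

lemma phi_mult_finer:
  assumes G: "equiv (fst G) (snd G)" and H: "equiv (fst H) (snd H)" and le: "graph_le G H"
  shows "phi H ** phi G = phi H"
proof -
  have sub: "snd G \<subseteq> snd H" and V: "fst G = fst H"
    using le by (simp_all add: graph_le_def)
  have "(\<Sum>k\<in>UNIV. phi H $ i $ k * phi G $ k $ j) = phi H $ i $ j" for i j
  proof -
    have "phi H $ i $ k * phi G $ k $ j = phi H $ i $ j * phi G $ k $ j" for k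
    proof (cases "(k, j) \<in> snd G")
      case True
      then have "(k, j) \<in> snd H"
        using sub by blast
      then have "(i, k) \<in> snd H \<longleftrightarrow> (i, j) \<in> snd H"
        using H by (meson equiv_def symD transD)
      then show ?thesis
        by (simp add: phi_nth_equiv[OF H])
    qed (simp add: phi_nth_equiv[OF G])
    then have "(\<Sum>k\<in>UNIV. phi H $ i $ k * phi G $ k $ j)
        = phi H $ i $ j * (\<Sum>k\<in>UNIV. phi G $ k $ j)"
      unfolding sum_distrib_left by (rule sum.cong[OF refl])
    \<comment> \<open>The column sum is 1 if j is a vertex; otherwise the factor
      \<open>phi H $ i $ j\<close> is 0.\<close>
    also have "\<dots> = phi H $ i $ j"
      using equiv_type[OF H] by (auto simp: sum_phi_column[OF G] V phi_nth_equiv[OF H])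
    finally show ?thesis .
  qed
  then show ?thesis
    by (simp add: matrix_matrix_mult_def vec_eq_iff)
qed

text \<open>The total depends on G only through its vertex set, which comparable graphs
  share.\<close>

lemma sum_phi_mult_vec:
  assumes "equiv (fst G) (snd G)"
  shows "(\<Sum>i\<in>UNIV. (phi G *v c) $ i) = (\<Sum>j\<in>fst G. c $ j)"
proof -
  have "(\<Sum>i\<in>UNIV. (phi G *v c) $ i) = (\<Sum>j\<in>UNIV. \<Sum>i\<in>UNIV. phi G $ i $ j * c $ j)"
    unfolding matrix_vector_mult_def by (simp add: sum.swap[of "\<lambda>i j. phi G $ i $ j * c $ j"])
  also have "\<dots> = (\<Sum>j\<in>UNIV. (\<Sum>i\<in>UNIV. phi G $ i $ j) * c $ j)"
    by (simp add: sum_distrib_right)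
  finally show ?thesis
    by (simp add: sum_phi_column[OF assms])
qed

lemma norm_phi_mult_antimono:
  assumes G: "equiv (fst G) (snd G)" and H: "equiv (fst H) (snd H)" and le: "graph_le G H"
  shows "norm (phi H *v c) \<le> norm (phi G *v c)"
proof -
  have "transpose (phi H) = phi H"
    by (simp add: transpose_def vec_eq_iff phi_sym[OF H])
  then have self_adjoint: "(phi H *v x) \<bullet> y = x \<bullet> (phi H *v y)" for x y
    by (metis dot_lmul_matrix transpose_matrix_vector)
  have "phi H ** phi H = phi H"
    using phi_mult_finer[OF H H] by (simp add: graph_le_def)
  \<comment> \<open>Self-adjointness and idempotence reduce the left side to the inner product of c
    and \<open>phi H *v c\<close>; then \<open>phi H\<close> is replaced by
    \<open>phi H ** phi G\<close>.\<close>
  then have "(phi H *v c) \<bullet> (phi H *v c) = (phi H *v (phi G *v c)) \<bullet> c"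
    using phi_mult_finer[OF G H le]
    by (simp add: self_adjoint matrix_vector_mul_assoc inner_commute)
  also have "\<dots> = (phi G *v c) \<bullet> (phi H *v c)"
    by (rule self_adjoint)
  also have "\<dots> \<le> norm (phi G *v c) * norm (phi H *v c)"
    by (rule norm_cauchy_schwarz)
  \<comment> \<open>Cancel one factor \<open>norm (phi H *v c)\<close>, unless it is 0.\<close>
  finally show ?thesis
    by (cases "phi H *v c = 0") (simp_all add: dot_square_norm power2_eq_square)
qed

text \<open>The zero matrix needs no separate case because \<open>0 / 0 = 0\<close>.\<close>

lemma N_eff_altdef:
  "N_eff a c = (\<Sum>i\<in>UNIV. (a *v c) $ i)\<^sup>2 / (norm (a *v c))\<^sup>2"
  by (simp add: N_eff_def matrix_vector_mult_def norm_vec_def L2_set_def sum_nonneg)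

theorem proposition3:
  fixes c :: "real ^ 'n::finite" and a a' :: "real ^ 'n ^ 'n"
  assumes "\<And>i. c $ i > 0"
    and "a \<in> cluster_matrices" and "a' \<in> cluster_matrices"
    and "matrix_le a a'"
  shows "N_eff a c \<le> N_eff a' c"
proof -
  obtain G H where G: "G \<in> cluster_graphs" "a = phi G" and H: "H \<in> cluster_graphs" "a' = phi H"
    using assms(2,3) by (auto simp: cluster_matrices_def)
  \<comment> \<open>Injectivity identifies the preimages chosen by \<open>matrix_le\<close> with G
    and H.\<close>
  have "inj_on phi (cluster_graphs :: 'n graph set)"
    using bij_betw_phi by (rule bij_betw_imp_inj_on)
  then have le: "graph_le G H"
    using assms(4) G H by (simp add: matrix_le_def the_inv_into_f_f)
  note equiv = cluster_graph_equiv[OF G(1)] cluster_graph_equiv[OF H(1)]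
  have num: "(\<Sum>i\<in>UNIV. (a *v c) $ i) = (\<Sum>i\<in>UNIV. (a' *v c) $ i)"
    using le unfolding G H sum_phi_mult_vec[OF equiv(1)] sum_phi_mult_vec[OF equiv(2)]
    by (simp add: graph_le_def)
  have den: "norm (a' *v c) \<le> norm (a *v c)"
    unfolding G H using equiv le by (rule norm_phi_mult_antimono)
  show ?thesis
  \<comment> \<open>If this vector vanishes, so does the common numerator, and both sides are
    0.\<close>
  proof (cases "a' *v c = 0")
    case True
    then show ?thesis
      by (simp add: N_eff_altdef num)
  next
    case False
    then have "0 < norm (a' *v c)"
      by simp
    then have "0 < (norm (a' *v c))\<^sup>2" "(norm (a' *v c))\<^sup>2 \<le> (norm (a *v c))\<^sup>2"
      using den by (auto intro: power_mono)
    then show ?thesis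
      unfolding N_eff_altdef num by (intro divide_left_mono mult_pos_pos) auto
  qed
qed

end
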